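(* The 2-color Rado number of the equation $x^2+y^2+z^2=w^2$ is $105$. That is, $105$ is the least positive integer $N$ such that for every coloring $\chi:\{1,2,\dots,N\}\to\{1,2\}$ there exist $x,y,z,w\in\{1,2,\dots,N\}$ with $x^2+y^2+z^2=w^2$ and $\chi(x)=\chi(y)=\chi(z)=\chi(w)$.
   Context: For an equation $\mathcal{E}$ in several variables and a positive integer $r$, the $r$-color Rado number of $\mathcal{E}$ is the least positive integer $N$ such that every coloring $\chi:\{1,\dots,N\}\to\{1,\dots,r\}$ admits a monochromatic solution of $\mathcal{E}$ (a solution in which all variables take values in $\{1,\dots,N\}$ receiving the same color); it is $\infty$ if no such $N$ exists. The variables in a solution need not be distinct. *)

theory Defs
  imports Complex_Main "HOL-Library.FuncSet" "HOL-Library.Extended_Nat"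
begin

(* An equation in k variables is given by its set of solutions in the natural
   numbers, each solution being the list [x_1, ..., x_k] of the values of the
   variables; entries of the list may repeat. *)

definition monochromatic_solution ::
    "nat list set \<Rightarrow> nat \<Rightarrow> (nat \<Rightarrow> nat) \<Rightarrow> nat list \<Rightarrow> bool" where
  "monochromatic_solution E N \<chi> s \<longleftrightarrow>
     s \<in> E \<and> set s \<subseteq> {1..N} \<and> (\<forall>u\<in>set s. \<forall>v\<in>set s. \<chi> u = \<chi> v)"

(* The infimum is taken in enat, where it is the least element of a nonempty
   set, and \<infinity> for the empty set. *)

definition rado_number :: "nat \<Rightarrow> nat list set \<Rightarrow> enat" where
  "rado_number r E =
     Inf {enat N | N. 1 \<le> N \<and>
       (\<forall>\<chi> \<in> {1..N} \<rightarrow> {1..r}. \<exists>s. monochromatic_solution E N \<chi> s)}"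

end

theory Submission
  imports Defs
begin

text \<open>
  Both bounds are finite computations. A colouring with two colours and no monochromatic
  solution is a satisfying assignment of the propositional formula saying that no solution
  quadruple has all its entries equal; up to 104 one such assignment (from a SAT solver) is exhibited, while
  for 105 a small unsatisfiable subset of the clauses, found by a lookahead search
  followed by deletion of redundant clauses, is refuted by resolution.
\<close>

section \<open>Testing a finite set of integers for solutions\<close>

fun disjoint_sorted :: "'a::linorder list \<Rightarrow> 'a list \<Rightarrow> bool" where
  "disjoint_sorted (x # xs) (y # ys) =
     (if x < y then disjoint_sorted xs (y # ys)
      else y < x \<and> disjoint_sorted (x # xs) ys)"
| "disjoint_sorted [] ys = True"
| "disjoint_sorted xs [] = True"

lemma disjoint_sorted_imp_disjoint:
  assumes "disjoint_sorted xs ys" "sorted xs" "sorted ys"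
  shows "set xs \<inter> set ys = {}"
  using assms by (induction xs ys rule: disjoint_sorted.induct) (fastforce split: if_splits)+

text \<open>
  The rewriting engine behind \<open>code_simp\<close> evaluates both branches of a conditional, and
  a congruence rule that prevents this makes it traverse the remaining lists again at every
  step. Passing the outcomes of the comparisons as arguments avoids both.
\<close>

definition disjoint_step :: "bool \<Rightarrow> bool \<Rightarrow> 'a::linorder \<Rightarrow> 'a list \<Rightarrow> 'a \<Rightarrow> 'a list \<Rightarrow> bool" where
  "disjoint_step lt gt x xs y ys =
     (if lt then disjoint_sorted xs (y # ys) else gt \<and> disjoint_sorted (x # xs) ys)"

lemma disjoint_step_code [code]:
  "disjoint_step True gt x xs y ys = disjoint_sorted xs (y # ys)"
  "disjoint_step False True x xs y ys = disjoint_sorted (x # xs) ys"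
  "disjoint_step False False x xs y ys = False"
  by (simp_all add: disjoint_step_def)

lemma disjoint_sorted_code [code]:
  "disjoint_sorted (x # xs) (y # ys) = disjoint_step (x < y) (y < x) x xs y ys"
  "disjoint_sorted [] ys = True"
  "disjoint_sorted (x # xs) [] = True"
  by (simp_all add: disjoint_step_def)

fun triangle :: "('a \<Rightarrow> 'a \<Rightarrow> 'b) \<Rightarrow> 'a list \<Rightarrow> 'b list list" where
  "triangle f [] = []"
| "triangle f (x # xs) = map (f x) (x # xs) # triangle f xs"

text \<open>If \<open>y\<close> preceded \<open>x\<close> in the list, then \<open>R y x\<close>
  would hold; hence \<open>y\<close> occurs in the row that starts at \<open>x\<close>, possibly as
  \<open>x\<close> itself.\<close>

lemma triangle_covers:
  assumes "sorted_wrt R xs" "x \<in> set xs" "y \<in> set xs" "\<not> R y x"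
  shows "\<exists>r \<in> set (triangle f xs). f x y \<in> set r"
  using assms by (induction xs) auto

text \<open>
  All rows of the two triangles are increasing, so that comparing \<open>x\<^sup>2 + y\<^sup>2\<close> with
  \<open>w\<^sup>2 - z\<^sup>2\<close> row by row avoids an enumeration of quadruples. The elements are
  integers because their binary numerals are evaluated directly by rewriting.
\<close>

definition solution_free :: "int list \<Rightarrow> bool" where
  "solution_free xs \<longleftrightarrow>
     (let sqsums = triangle (\<lambda>x y. x * x + y * y) xs;
          sqdiffs = triangle (\<lambda>w z. w * w - z * z) (rev xs)
      in sorted_wrt (<) xs \<and> list_all sorted sqsums \<and> list_all sorted sqdiffs \<and>
         list_all id (map (\<lambda>r. list_all id (map (disjoint_sorted r) sqdiffs)) sqsums))"

text \<open>A solution in \<open>xs\<close> would make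
  \<open>x\<^sup>2 + y\<^sup>2 = w\<^sup>2 - z\<^sup>2\<close> a common entry of a row of sums and a
  row of differences, which have been checked to be disjoint.\<close>

lemma solution_free:
  assumes free: "solution_free xs"
    and pos: "0 < x" "0 < y" "0 < z" "0 < w" and eq: "x\<^sup>2 + y\<^sup>2 + z\<^sup>2 = w\<^sup>2"
  shows "\<not> {x, y, z, w} \<subseteq> set xs"
proof
  assume mem: "{x, y, z, w} \<subseteq> set xs"
  let ?S = "triangle (\<lambda>x y. x * x + y * y) xs"
  let ?D = "triangle (\<lambda>w z. w * w - z * z) (rev xs)"
  have inc: "sorted_wrt (<) xs" and sorted: "list_all sorted ?S" "list_all sorted ?D"
    and disj: "list_all (\<lambda>r. list_all (disjoint_sorted r) ?D) ?S"
    using free by (simp_all add: solution_free_def Let_def list_all_iff)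
  have "z\<^sup>2 < w\<^sup>2"
    using pos eq by (smt (verit) zero_less_power)
  then have "z < w"
    using \<open>0 < w\<close> by (simp add: power_less_imp_less_base)
  \<comment> \<open>The reversed list is decreasing, so \<open>z < w\<close> places \<open>z\<close>
    after \<open>w\<close>, in the row of \<open>w\<close>.\<close>
  then obtain d where d: "d \<in> set ?D" "w * w - z * z \<in> set d"
    using triangle_covers[of "\<lambda>a b. b < a" "rev xs" w z "\<lambda>w z. w * w - z * z"] inc mem
    by (auto simp: sorted_wrt_rev)
  have row: "\<exists>s \<in> set ?S. a * a + b * b \<in> set s" if "a \<in> set xs" "b \<in> set xs" "a \<le> b" for a b
    using triangle_covers[OF inc that(1,2), of "\<lambda>x y. x * x + y * y"] that(3) by simp
  \<comment> \<open>The triangle of sums holds each pair in one order only; symmetry of the sum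
    covers the other.\<close>
  obtain s where s: "s \<in> set ?S" "x * x + y * y \<in> set s"
    using row[of x y] row[of y x] mem linear[of x y] by (auto simp: add.commute)
  have "set s \<inter> set d = {}"
    using s(1) d(1) sorted disj by (intro disjoint_sorted_imp_disjoint) (simp_all add: list_all_iff)
  moreover have "x * x + y * y = w * w - z * z"
    using eq by (simp add: power2_eq_square)
  ultimately show False
    using s(2) d(2) by auto
qed

section \<open>Lower bound: an avoiding colouring\<close>

definition red :: "int list" where
  "red =
    [
     1, 4, 6, 9, 10, 11, 14, 16, 17, 21, 24, 25, 26, 30, 31, 34, 36, 39, 44, 45, 46,
     49, 50, 53, 54, 56, 57, 58, 60, 63, 64, 66, 70, 73, 74, 76, 77, 80, 82, 83, 84,
     87, 88, 92, 93, 94, 96, 97, 98, 100, 102, 103, 104]"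

definition blue :: "int list" where
  "blue =
    [
     2, 3, 5, 7, 8, 12, 13, 15, 18, 19, 20, 22, 23, 27, 28, 29, 32, 33, 35, 37, 38,
     40, 41, 42, 43, 47, 48, 51, 52, 55, 59, 61, 62, 65, 67, 68, 69, 71, 72, 75, 78,
     79, 81, 85, 86, 89, 90, 91, 95, 99, 101]"

lemma solution_free_red: "solution_free red"
  by code_simp

lemma solution_free_blue: "solution_free blue"
  by code_simp

lemma red_blue_cover: "{1..104} \<subseteq> set red \<union> set blue"
proof -
  have "set [1..104] \<subseteq> set red \<union> set blue"
    \<comment> \<open>The interval is written out as an explicit list, which \<open>set_upto\<close>
      would undo; \<open>upto.simps[of 1]\<close> starts the unfolding at \<open>1\<close>.\<close>
    by (simp add: red_def blue_def upto.simps[of 1] del: set_upto)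
  then show ?thesis
    by (simp only: set_upto)
qed

lemma avoiding_colouring_104:
  obtains \<chi> :: "nat \<Rightarrow> nat" where "range \<chi> \<subseteq> {1..2}"
    and "\<And>x y z w. {x, y, z, w} \<subseteq> {1..104} \<Longrightarrow> x\<^sup>2 + y\<^sup>2 + z\<^sup>2 = w\<^sup>2 \<Longrightarrow>
           \<not> (\<chi> x = \<chi> w \<and> \<chi> y = \<chi> w \<and> \<chi> z = \<chi> w)"
proof
  \<comment> \<open>Colour 2 is also the default outside \<open>{1..104}\<close>, so the colouring
    is total with range in \<open>{1..2}\<close> and can serve for every shorter interval.\<close>
  let ?c = "\<lambda>n::nat. if int n \<in> set red then 1 else 2 :: nat"
  show "range ?c \<subseteq> {1..2}"
    by auto
  fix x y z w :: nat
  assume bounds: "{x, y, z, w} \<subseteq> {1..104}" and eq: "x\<^sup>2 + y\<^sup>2 + z\<^sup>2 = w\<^sup>2"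
  have pos: "0 < int x" "0 < int y" "0 < int z" "0 < int w"
    using bounds by auto
  have eq': "(int x)\<^sup>2 + (int y)\<^sup>2 + (int z)\<^sup>2 = (int w)\<^sup>2"
    using eq by (metis of_nat_add of_nat_power)
  have blue: "int n \<in> set blue" if "n \<in> {x, y, z, w}" "int n \<notin> set red" for n
  proof -
    have "int n \<in> {1..104}"
      using that(1) bounds by auto
    then show ?thesis
      using that(2) red_blue_cover by blast
  qed
  show "\<not> (?c x = ?c w \<and> ?c y = ?c w \<and> ?c z = ?c w)"
  proof
    assume same: "?c x = ?c w \<and> ?c y = ?c w \<and> ?c z = ?c w"
    show False
    proof (cases "int w \<in> set red")
      case True
      then have "{int x, int y, int z, int w} \<subseteq> set red"
        using same by (simp split: if_splits)
      then show False
        using solution_free[OF solution_free_red pos eq'] by contradiction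
    next
      case False
      then have "{int x, int y, int z, int w} \<subseteq> set blue"
        using same blue by (simp split: if_splits)
      then show False
        using solution_free[OF solution_free_blue pos eq'] by contradiction
    qed
  qed
qed

section \<open>Upper bound: solutions that cannot all be avoided\<close>

definition unavoidable_solutions :: "(nat \<times> nat \<times> nat \<times> nat) list" where
  "unavoidable_solutions =
    [
     (1,2,2,3), (2,4,4,6), (1,4,8,9), (3,6,6,9), (4,4,7,9), (2,6,9,11), (6,6,7,11),
     (8,9,12,17), (2,8,16,18), (6,12,12,18), (8,8,14,18), (6,9,18,21), (7,14,14,21),
     (8,11,16,21), (4,12,18,22), (12,12,14,22), (9,12,20,25), (2,10,25,27),
     (9,18,18,27), (10,10,23,27), (12,12,21,27), (8,12,24,28), (6,14,27,31),
     (6,21,22,31), (14,18,21,31), (6,18,27,33), (7,16,28,33), (8,8,31,33),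
     (11,22,22,33), (17,20,20,33), (18,18,21,33), (12,24,24,36), (16,16,28,36),
     (3,8,36,37), (12,21,28,37), (12,12,34,38), (4,24,33,41), (9,24,32,41),
     (12,18,36,42), (16,22,32,42), (2,21,42,47), (6,27,38,47), (11,18,42,47),
     (18,21,38,47), (18,27,34,47), (16,32,32,48), (4,33,36,49), (9,32,36,49),
     (12,31,36,49), (23,24,36,49), (24,30,32,50), (3,36,36,51), (10,10,49,51),
     (14,14,47,51), (14,31,38,51), (17,34,34,51), (22,31,34,51), (24,27,36,51),
     (12,16,48,52), (8,12,51,53), (8,21,48,53), (12,27,44,53), (4,20,50,54),
     (6,24,48,54), (14,28,44,54), (18,36,36,54), (20,20,46,54), (24,24,42,54),
     (8,28,49,57), (17,32,44,57), (18,18,51,57), (28,28,41,57), (22,24,48,58),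
     (6,14,57,59), (9,22,54,59), (30,30,41,59), (11,36,48,61), (21,24,52,61),
     (12,42,44,62), (28,36,42,62), (2,22,59,63), (11,22,58,63), (12,24,57,63),
     (18,27,54,63), (21,42,42,63), (24,33,48,63), (28,28,49,63), (16,16,62,66),
     (22,44,44,66), (34,40,40,66), (36,36,42,66), (6,22,63,67), (6,33,58,67),
     (14,18,63,67), (18,42,49,67), (22,33,54,67), (30,33,50,67), (31,42,42,67),
     (4,16,67,69), (4,44,53,69), (9,42,54,69), (23,46,46,69), (30,36,52,70),
     (8,32,64,72), (24,28,63,73), (33,44,48,73), (3,12,76,77), (12,36,67,77),
     (12,48,59,77), (13,24,72,77), (14,42,63,77), (32,48,51,77), (42,42,49,77),
     (18,24,72,78), (9,36,72,81), (21,42,66,81), (27,54,54,81), (30,30,69,81),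
     (36,36,63,81), (12,59,60,85), (14,60,60,86), (18,36,76,86), (24,28,81,89),
     (24,57,64,89), (36,36,73,89), (30,60,60,90), (40,40,70,90), (4,52,77,93),
     (18,42,81,93), (18,63,66,93), (31,62,62,93), (36,42,76,94), (30,30,85,95),
     (42,50,69,95), (12,52,81,97), (16,63,72,97), (47,60,60,97), (2,49,86,99),
     (14,14,97,99), (24,24,93,99), (31,38,86,99), (33,66,66,99), (44,44,77,99),
     (49,50,70,99), (51,60,60,99), (54,54,63,99), (6,72,72,102), (28,28,94,102),
     (6,13,102,103), (6,67,78,103), (14,42,93,103), (18,22,99,103), (18,66,77,103),
     (14,70,77,105), (20,52,89,105)]"

lemma unavoidable_solutions_correct:
  assumes "(x, y, z, w) \<in> set unavoidable_solutions"
  shows "x\<^sup>2 + y\<^sup>2 + z\<^sup>2 = w\<^sup>2" "{x, y, z, w} \<subseteq> {1..105}"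
proof -
  have "list_all (\<lambda>(x, y, z, w). x\<^sup>2 + y\<^sup>2 + z\<^sup>2 = w\<^sup>2 \<and> {x, y, z, w} \<subseteq> {1..105})
      unavoidable_solutions"
    by (simp add: unavoidable_solutions_def)
  then show "x\<^sup>2 + y\<^sup>2 + z\<^sup>2 = w\<^sup>2" "{x, y, z, w} \<subseteq> {1..105}"
    using assms by (auto simp: list_all_iff)
qed

text \<open>A predicate in place of a colouring gives one propositional atom \<open>P n\<close> per
  number. Unfolded, the negated goal has two clauses per quadruple, not all true and not all false,
  which \<open>sat\<close> refutes.\<close>

lemma unavoidable_solutions_monochromatic:
  fixes P :: "nat \<Rightarrow> bool"
  shows "\<exists>(x, y, z, w) \<in> set unavoidable_solutions.
           (P x \<and> P y \<and> P z \<and> P w) \<or> (\<not> P x \<and> \<not> P y \<and> \<not> P z \<and> \<not> P w)"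
  unfolding unavoidable_solutions_def list.set bex_simps prod.case
  by sat

section \<open>The value of the Rado number\<close>

theorem theorem1:
  "rado_number 2 {[x, y, z, w] | x y z w. x\<^sup>2 + y\<^sup>2 + z\<^sup>2 = w\<^sup>2} = 105"
proof -
  let ?E = "{[x, y, z, w] | x y z w. x\<^sup>2 + y\<^sup>2 + z\<^sup>2 = w\<^sup>2} :: nat list set"
  let ?S = "{N. 1 \<le> N \<and>
      (\<forall>\<chi> \<in> {1..N} \<rightarrow> {1..2}. \<exists>s. monochromatic_solution ?E N \<chi> s)}"
  have "105 \<in> ?S"
  proof (intro CollectI conjI ballI)
    fix \<chi> :: "nat \<Rightarrow> nat" assume \<chi>: "\<chi> \<in> {1..105} \<rightarrow> {1..2}"
    from unavoidable_solutions_monochromatic[of "\<lambda>n. \<chi> n = 1"]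
    obtain x y z w where mem: "(x, y, z, w) \<in> set unavoidable_solutions"
      and mono: "(\<chi> x = 1 \<and> \<chi> y = 1 \<and> \<chi> z = 1 \<and> \<chi> w = 1) \<or>
                 (\<chi> x \<noteq> 1 \<and> \<chi> y \<noteq> 1 \<and> \<chi> z \<noteq> 1 \<and> \<chi> w \<noteq> 1)"
      by auto
    note sol = unavoidable_solutions_correct[OF mem]
    \<comment> \<open>The predicate only separates colour 1 from the rest; with two colours
      available, the entries that fail it share a colour too.\<close>
    have two: "\<chi> n = 2" if "n \<in> {x, y, z, w}" "\<chi> n \<noteq> 1" for n
    proof -
      have "\<chi> n \<in> {1..2}"
        using \<chi> sol(2) that(1) by (blast dest: funcset_mem)
      then show ?thesis
        using that(2) by auto
    qed
    have "\<chi> u = \<chi> v" if "u \<in> {x, y, z, w}" "v \<in> {x, y, z, w}" for u v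
      using mono that two[of u] two[of v] by auto
    then have "\<forall>u \<in> set [x, y, z, w]. \<forall>v \<in> set [x, y, z, w]. \<chi> u = \<chi> v"
      unfolding list.set by blast
    moreover have "[x, y, z, w] \<in> ?E"
      using sol(1) by blast
    moreover have "set [x, y, z, w] \<subseteq> {1..105}"
      using sol(2) unfolding list.set .
    ultimately have "monochromatic_solution ?E 105 \<chi> [x, y, z, w]"
      unfolding monochromatic_solution_def by blast
    then show "\<exists>s. monochromatic_solution ?E 105 \<chi> s" ..
  qed simp
  moreover have "105 \<le> N" if N: "N \<in> ?S" for N
  proof (rule ccontr)
    assume "\<not> 105 \<le> N"
    then have sub: "{1..N} \<subseteq> {1..104}"
      by auto
    obtain \<chi> :: "nat \<Rightarrow> nat" where range: "range \<chi> \<subseteq> {1..2}"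
      and avoid: "\<And>x y z w. {x, y, z, w} \<subseteq> {1..104} \<Longrightarrow> x\<^sup>2 + y\<^sup>2 + z\<^sup>2 = w\<^sup>2 \<Longrightarrow>
           \<not> (\<chi> x = \<chi> w \<and> \<chi> y = \<chi> w \<and> \<chi> z = \<chi> w)"
      by (rule avoiding_colouring_104) blast
    have "\<chi> \<in> {1..N} \<rightarrow> {1..2}"
      using range by auto
    with N obtain s where s: "monochromatic_solution ?E N \<chi> s"
      by blast
    then obtain x y z w where list: "s = [x, y, z, w]" and eq: "x\<^sup>2 + y\<^sup>2 + z\<^sup>2 = w\<^sup>2"
      unfolding monochromatic_solution_def by blast
    have "{x, y, z, w} \<subseteq> {1..N}" "\<chi> x = \<chi> w" "\<chi> y = \<chi> w" "\<chi> z = \<chi> w"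
      using s unfolding monochromatic_solution_def list list.set by blast+
    then show False
      using avoid[of x y z w] eq sub by blast
  qed
  \<comment> \<open>Being a member and a lower bound, 105 is the infimum, also in
    \<open>enat\<close>.\<close>
  ultimately have "Inf {enat N | N. N \<in> ?S} = enat 105"
    by (intro antisym Inf_lower Inf_greatest) auto
  then show ?thesis
    by (simp add: rado_number_def numeral_eq_enat)
qed

end
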